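(* Let $X=\{x_1,\dots,x_n\}$, let $f$ be a permutation of $\{1,\dots,n\}$, and let $(X,S)$ be the permutation solution $S(i,j)=(f(j),f^{-1}(i))$ (i.e. $S(x_i,x_j)=(x_{f(j)},x_{f^{-1}(i)})$). Write $f$ as a product of disjoint cycles $$f=(t_{1,1},\dots,t_{1,m_1})(t_{2,1},\dots,t_{2,m_2})\cdots(t_{k,1},\dots,t_{k,m_k})(s_1)\cdots(s_l).$$ Let $M$ be the monoid with the same presentation as the structure group of $(X,S)$. Then the element $$\Delta=x_{t_1}^{m_1}x_{t_2}^{m_2}\cdots x_{t_k}^{m_k}x_{s_1}\cdots x_{s_l}$$ is a Garside element of $M$.
   Context: $M$ is the monoid generated by $X$ with defining relations $x_ix_j=x_{f(j)}x_{f^{-1}(i)}$ for all $i,j$. Every element of $\{1,\dots,n\}$ is one of the $t_{i,p}$ or one of the fixed points $s_1,\dots,s_l$. For each $1\le i\le k$, $x_{t_i}^{m_i}$ denotes any one of the elements $x_{t_{i,1}}^{m_i},\dots,x_{t_{i,m_i}}^{m_i}$ (these all represent the same element of $M$). In a monoid, $x$ is a left (resp. right) divisor of $z$ if $z=xt$ (resp. $z=tx$) for some $t$. A Garside element is an element whose left divisors coincide with its right divisors, are finite in number, and generate the monoid. *)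

theory Defs
  imports "HOL-Algebra.Group" "HOL-Combinatorics.Cycles"
begin

section \<open>Monoids given by generators and relations\<close>

text \<open>The congruence on the free monoid of words over \<open>X\<close> generated by the defining relations
  \<open>R\<close>; a pair \<open>(u, v)\<close> in \<open>R\<close> stands for the relation \<open>u = v\<close>.\<close>

inductive_set presentation_cong :: "'a set \<Rightarrow> ('a list \<times> 'a list) set \<Rightarrow> ('a list \<times> 'a list) set"
  for X :: "'a set" and R :: "('a list \<times> 'a list) set"
where
  base: "(u, v) \<in> R \<Longrightarrow> u \<in> lists X \<Longrightarrow> v \<in> lists X \<Longrightarrow> (u, v) \<in> presentation_cong X R"
| refl: "u \<in> lists X \<Longrightarrow> (u, u) \<in> presentation_cong X R"
| sym: "(u, v) \<in> presentation_cong X R \<Longrightarrow> (v, u) \<in> presentation_cong X R"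
| trans: "(u, v) \<in> presentation_cong X R \<Longrightarrow> (v, w) \<in> presentation_cong X R
    \<Longrightarrow> (u, w) \<in> presentation_cong X R"
| append: "(u, v) \<in> presentation_cong X R \<Longrightarrow> (u', v') \<in> presentation_cong X R
    \<Longrightarrow> (u @ u', v @ v') \<in> presentation_cong X R"

definition presented_monoid :: "'a set \<Rightarrow> ('a list \<times> 'a list) set \<Rightarrow> 'a list set monoid" where
  "presented_monoid X R =
    \<lparr>carrier = lists X // presentation_cong X R,
     monoid.mult = (\<lambda>A B. \<Union>u\<in>A. \<Union>v\<in>B. presentation_cong X R `` {u @ v}),
     one = presentation_cong X R `` {[]}\<rparr>"

definition presented_gen :: "'a set \<Rightarrow> ('a list \<times> 'a list) set \<Rightarrow> 'a \<Rightarrow> 'a list set" where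
  "presented_gen X R x = presentation_cong X R `` {[x]}"

lemma presentation_cong_in_lists:
  "(u, v) \<in> presentation_cong X R \<Longrightarrow> u \<in> lists X \<and> v \<in> lists X"
  by (induction rule: presentation_cong.induct) auto

lemma equiv_presentation_cong: "equiv (lists X) (presentation_cong X R)"
  by (intro equivI refl_onI symI transI)
     (auto dest: presentation_cong_in_lists intro: presentation_cong.intros)

lemma presented_mult_class:
  assumes "u \<in> lists X" "v \<in> lists X"
  shows "presentation_cong X R `` {u} \<otimes>\<^bsub>presented_monoid X R\<^esub> presentation_cong X R `` {v}
    = presentation_cong X R `` {u @ v}"
proof -
  have "congruent2 (presentation_cong X R) (presentation_cong X R)
      (\<lambda>u v. presentation_cong X R `` {u @ v})"
    by (intro congruent2I' equiv_class_eq[OF equiv_presentation_cong] presentation_cong.append)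
  from UN_equiv_class2[OF equiv_presentation_cong equiv_presentation_cong this] assms
  show ?thesis by (simp add: presented_monoid_def)
qed

lemma monoid_presented_monoid: "monoid (presented_monoid X R)"
proof -
  let ?c = "\<lambda>u. presentation_cong X R `` {u}"
  have carr: "carrier (presented_monoid X R) = ?c ` lists X"
    by (auto simp: presented_monoid_def quotient_def)
  have one: "\<one>\<^bsub>presented_monoid X R\<^esub> = ?c []"
    by (simp add: presented_monoid_def)
  show ?thesis
  proof (rule monoidI)
    fix A B assume "A \<in> carrier (presented_monoid X R)" "B \<in> carrier (presented_monoid X R)"
    then obtain u v where "A = ?c u" "B = ?c v" "u \<in> lists X" "v \<in> lists X"
      unfolding carr by blast
    then show "A \<otimes>\<^bsub>presented_monoid X R\<^esub> B \<in> carrier (presented_monoid X R)"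
      unfolding carr by (simp only: presented_mult_class) (rule imageI, simp)
  next
    fix A B C
    assume "A \<in> carrier (presented_monoid X R)" "B \<in> carrier (presented_monoid X R)"
      "C \<in> carrier (presented_monoid X R)"
    then obtain u v w where "A = ?c u" "B = ?c v" "C = ?c w"
      "u \<in> lists X" "v \<in> lists X" "w \<in> lists X"
      unfolding carr by blast
    then show "A \<otimes>\<^bsub>presented_monoid X R\<^esub> B \<otimes>\<^bsub>presented_monoid X R\<^esub> C
        = A \<otimes>\<^bsub>presented_monoid X R\<^esub> (B \<otimes>\<^bsub>presented_monoid X R\<^esub> C)"
      by (simp only: presented_mult_class append_in_lists_conv append_assoc)
  next
    fix A assume "A \<in> carrier (presented_monoid X R)"
    then obtain u where u: "A = ?c u" "u \<in> lists X"
      unfolding carr by blast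
    show "\<one>\<^bsub>presented_monoid X R\<^esub> \<otimes>\<^bsub>presented_monoid X R\<^esub> A = A"
      unfolding one u(1) by (simp only: presented_mult_class lists.Nil u(2) append_Nil)
    show "A \<otimes>\<^bsub>presented_monoid X R\<^esub> \<one>\<^bsub>presented_monoid X R\<^esub> = A"
      unfolding one u(1) by (simp only: presented_mult_class lists.Nil u(2) append_Nil2)
  next
    show "\<one>\<^bsub>presented_monoid X R\<^esub> \<in> carrier (presented_monoid X R)"
      unfolding carr one by (rule imageI) simp
  qed
qed

lemma presented_gen_closed:
  "x \<in> X \<Longrightarrow> presented_gen X R x \<in> carrier (presented_monoid X R)"
  by (auto simp: presented_gen_def presented_monoid_def intro: quotientI)

section \<open>The presentation attached to a set-theoretical solution\<close>

text \<open>The structure group of \<open>(X, S)\<close> and its monoid both have generators \<open>X\<close> and these relations: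
  \<open>x y = z t\<close> whenever \<open>S (x, y) = (z, t)\<close>.\<close>

definition structure_rels :: "'a set \<Rightarrow> ('a \<times> 'a \<Rightarrow> 'a \<times> 'a) \<Rightarrow> ('a list \<times> 'a list) set" where
  "structure_rels X S = {([x, y], [z, t]) | x y z t. x \<in> X \<and> y \<in> X \<and> S (x, y) = (z, t)}"

definition structure_monoid :: "'a set \<Rightarrow> ('a \<times> 'a \<Rightarrow> 'a \<times> 'a) \<Rightarrow> 'a list set monoid" where
  "structure_monoid X S = presented_monoid X (structure_rels X S)"

definition structure_gen :: "'a set \<Rightarrow> ('a \<times> 'a \<Rightarrow> 'a \<times> 'a) \<Rightarrow> 'a \<Rightarrow> 'a list set" where
  "structure_gen X S x = presented_gen X (structure_rels X S) x"

definition permutation_solution :: "('a \<Rightarrow> 'a) \<Rightarrow> 'a \<times> 'a \<Rightarrow> 'a \<times> 'a" where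
  "permutation_solution f = (\<lambda>(i, j). (f j, inv_into UNIV f i))"

section \<open>Garside elements\<close>

definition left_divisors :: "('a, 'b) monoid_scheme \<Rightarrow> 'a \<Rightarrow> 'a set" where
  "left_divisors G z = {x \<in> carrier G. \<exists>t\<in>carrier G. z = x \<otimes>\<^bsub>G\<^esub> t}"

definition right_divisors :: "('a, 'b) monoid_scheme \<Rightarrow> 'a \<Rightarrow> 'a set" where
  "right_divisors G z = {x \<in> carrier G. \<exists>t\<in>carrier G. z = t \<otimes>\<^bsub>G\<^esub> x}"

text \<open>Generation is as a monoid (the library's \<open>generate\<close> also closes under inverses).\<close>

definition monoid_generated_by :: "('a, 'b) monoid_scheme \<Rightarrow> 'a set \<Rightarrow> bool" where
  "monoid_generated_by G A \<longleftrightarrow>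
    A \<subseteq> carrier G \<and> (\<forall>H. submonoid H G \<and> A \<subseteq> H \<longrightarrow> H = carrier G)"

definition garside_element :: "('a, 'b) monoid_scheme \<Rightarrow> 'a \<Rightarrow> bool" where
  "garside_element G d \<longleftrightarrow>
    d \<in> carrier G \<and>
    left_divisors G d = right_divisors G d \<and>
    finite (left_divisors G d) \<and>
    monoid_generated_by G (left_divisors G d)"

section \<open>Cycle decompositions and the element in question\<close>

text \<open>\<open>cycle_of_list [t\<^sub>1, \<dots>, t\<^sub>m]\<close> sends each \<open>t\<^sub>p\<close> to \<open>t\<^sub>p\<^sub>+\<^sub>1\<close> and \<open>t\<^sub>m\<close> to \<open>t\<^sub>1\<close>; the lists in
  \<open>ts\<close> are the cycles \<open>(t\<^sub>i\<^sub>,\<^sub>1, \<dots>, t\<^sub>i\<^sub>,\<^sub>m\<^sub>i)\<close> and \<open>ss\<close> lists the fixed points.\<close>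

definition is_cycle_decomposition ::
    "'a set \<Rightarrow> ('a \<Rightarrow> 'a) \<Rightarrow> 'a list list \<Rightarrow> 'a list \<Rightarrow> bool" where
  "is_cycle_decomposition X f ts ss \<longleftrightarrow>
    [] \<notin> set ts \<and>
    distinct (concat ts @ ss) \<and>
    set (concat ts @ ss) = X \<and>
    f = foldr (\<circ>) (map cycle_of_list (ts @ map (\<lambda>s. [s]) ss)) id"

text \<open>Position \<open>i\<close> of \<open>ts\<close> contributes the power \<open>x\<^sub>c\<^sub>i\<^bsup>m\<^sub>i\<^esup>\<close> with \<open>m\<^sub>i\<close> the length of the cycle; \<open>c i\<close> is
  the chosen entry of that cycle.\<close>

definition permutation_delta ::
    "('m, 'b) monoid_scheme \<Rightarrow> ('a \<Rightarrow> 'm) \<Rightarrow> 'a list list \<Rightarrow> 'a list \<Rightarrow> (nat \<Rightarrow> 'a) \<Rightarrow> 'm" where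
  "permutation_delta G x ts ss c =
    foldr (\<otimes>\<^bsub>G\<^esub>)
      (map (\<lambda>i. x (c i) [^]\<^bsub>G\<^esub> length (ts ! i)) [0..<length ts] @ map x ss) \<one>\<^bsub>G\<^esub>"

end

theory Submission
  imports Defs
begin

text \<open>
  Up to a shift of each letter by the power of \<open>f\<close> given by its position, the defining relations
  just interchange neighbouring letters. So attach to the word \<open>a\<^sub>0 a\<^sub>1 \<dots> a\<^sub>r\<close> the
  multiset (its weight) of the \<open>f\<^sup>k a\<^sub>k\<close>. The two sides of a
  relation \<open>i j = f(j) f\<^sup>-\<^sup>1(i)\<close> both have the multiset \<open>{i, f(j)}\<close>, so
  the multiset is an invariant of the congruence. It is complete (\<open>cong_iff_weight_eq\<close>), because
  the relations suffice to bring any entry of the multiset to the front of the word, and every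
  multiset over the alphabet occurs (\<open>weight_surj\<close>). Hence the monoid is the set of multisets over
  the alphabet with the product \<open>A \<cdot> B = A + f\<^sup>|\<^sup>A\<^sup>| B\<close>.

  In this model the left divisors of \<open>D\<close> are the \<open>A \<subseteq> D\<close>, and the right divisors are the \<open>A\<close> with
  \<open>f\<^sup>k A \<subseteq> D\<close>, where \<open>k = |D| - |A|\<close>. If \<open>D\<close> is stable under \<open>f\<close>, both conditions say \<open>A \<subseteq> D\<close>; and if
  moreover \<open>D\<close> contains each letter, all generators are among the divisors. So every \<open>f\<close>-stable
  multiset of full support is a Garside element (\<open>garside_element_of_stable_weight\<close>).

  It remains to see that \<open>\<Delta>\<close> is such a multiset. The power \<open>x\<^sub>c\<^sup>m\<close> has the multiset
  \<open>{c, f c, \<dots>, f\<^sup>m\<^sup>-\<^sup>1 c}\<close>, which for \<open>c\<close> on a cycle of length \<open>m\<close> is that cycle,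
  whatever the choice of \<open>c\<close>. Cycles are stable under \<open>f\<close>, so their product is their sum, and
  \<open>\<Delta>\<close> corresponds to the alphabet with all multiplicities one.
\<close>

section \<open>Words up to the relations are multisets\<close>

text \<open>A Horner scheme: shifting the weight of the tail by \<open>f\<close> at every step makes the letter at
  position \<open>k\<close>, counted from zero, contribute its image under \<open>f\<^sup>k\<close>.\<close>

primrec weight :: "('a \<Rightarrow> 'a) \<Rightarrow> 'a list \<Rightarrow> 'a multiset" where
  "weight f [] = {#}"
| "weight f (a # w) = add_mset a (image_mset f (weight f w))"

lemma size_weight [simp]: "size (weight f w) = length w"
  by (induction w) auto

lemma weight_append:
  "weight f (u @ v) = weight f u + image_mset (f ^^ length u) (weight f v)"
  by (induction u) (auto simp: multiset.map_comp comp_def)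

lemma weight_in_alphabet:
  assumes "f permutes X" "w \<in> lists X"
  shows "set_mset (weight f w) \<subseteq> X"
  using assms(2)
  by (induction w) (use permutes_in_image[OF assms(1)] in auto)

abbreviation word_cong :: "'a set \<Rightarrow> ('a \<Rightarrow> 'a) \<Rightarrow> ('a list \<times> 'a list) set" where
  "word_cong X f \<equiv> presentation_cong X (structure_rels X (permutation_solution f))"

lemma weight_eq_of_cong:
  assumes "f permutes X" "(u, v) \<in> word_cong X f"
  shows "weight f u = weight f v"
  using assms(2)
proof (induction rule: presentation_cong.induct)
  case (base u v)
  from base(1) obtain x y where "u = [x, y]" "v = [f y, inv_into UNIV f x]"
    by (auto simp: structure_rels_def permutation_solution_def)
  then show ?case using permutes_inverses(1)[OF assms(1)] by (simp add: add_mset_commute)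
next
  case (append u v u' v')
  have "length u = length v" using append.IH(1) by (metis size_weight)
  then show ?case by (simp only: weight_append append.IH)
qed simp_all

text \<open>A letter of the multiset that stems from a later position can be carried to the front: the
  relation \<open>b a = f(a) f\<^sup>-\<^sup>1(b)\<close> moves it one place to the left and applies \<open>f\<close> to it.\<close>

lemma cong_move_to_front:
  assumes f: "f permutes X" and "v \<in> lists X" "a \<in># weight f v"
  shows "\<exists>v'. v' \<in> lists X \<and> (v, a # v') \<in> word_cong X f"
  using assms(2,3)
proof (induction v arbitrary: a rule: list.induct)
  case Nil
  then show ?case by simp
next
  case (Cons b v)
  have b: "b \<in> X" and v: "v \<in> lists X" using Cons.prems(1) by auto
  show ?case
  proof (cases "a = b")
    case True
    then show ?thesis using presentation_cong.refl[OF Cons.prems(1)] v by blast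
  next
    case False
    with Cons.prems(2) obtain a' where a': "a' \<in># weight f v" "a = f a'" by auto
    from Cons.IH[OF v a'(1)] obtain v' where
      v': "v' \<in> lists X" "(v, a' # v') \<in> word_cong X f" by blast
    have X: "a' \<in> X" "f a' \<in> X" "inv_into UNIV f b \<in> X"
      using weight_in_alphabet[OF f v] a'(1) b permutes_in_image[OF f]
        permutes_in_image[OF permutes_inv[OF f]] by auto
    have "([b] @ v, [b] @ (a' # v')) \<in> word_cong X f"
      by (rule presentation_cong.append[OF presentation_cong.refl v'(2)]) (simp add: b)
    moreover have "([b, a'], [f a', inv_into UNIV f b]) \<in> word_cong X f"
      by (rule presentation_cong.base)
        (simp_all add: b X structure_rels_def permutation_solution_def)
    then have "([b, a'] @ v', [f a', inv_into UNIV f b] @ v') \<in> word_cong X f"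
      by (rule presentation_cong.append[OF _ presentation_cong.refl[OF v'(1)]])
    ultimately have "(b # v, a # (inv_into UNIV f b # v')) \<in> word_cong X f"
      unfolding a'(2) append_Cons append_Nil by (rule presentation_cong.trans)
    moreover have "inv_into UNIV f b # v' \<in> lists X" using X(3) v'(1) by simp
    ultimately show ?thesis by blast
  qed
qed

lemma cong_iff_weight_eq:
  assumes f: "f permutes X" and "u \<in> lists X" "v \<in> lists X"
  shows "(u, v) \<in> word_cong X f \<longleftrightarrow> weight f u = weight f v"
proof
  assume "weight f u = weight f v"
  with assms(2,3) show "(u, v) \<in> word_cong X f"
  proof (induction u arbitrary: v rule: list.induct)
    case Nil
    then have "v = []" by (metis size_weight list.size(3) length_0_conv)
    then show ?case by (simp add: presentation_cong.refl)
  next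
    case (Cons a u)
    have a: "a \<in> X" and u: "u \<in> lists X" using Cons.prems(1) by auto
    have "a \<in># weight f v" using Cons.prems(3) by (metis weight.simps(2) union_single_eq_member)
    from cong_move_to_front[OF f Cons.prems(2) this] obtain v' where
      v': "v' \<in> lists X" "(v, a # v') \<in> word_cong X f" by blast
    have "image_mset f (weight f u) = image_mset f (weight f v')"
      using weight_eq_of_cong[OF f v'(2)] Cons.prems(3) by simp
    then have "image_mset (inv_into UNIV f) (image_mset f (weight f u))
        = image_mset (inv_into UNIV f) (image_mset f (weight f v'))" by simp
    then have "weight f u = weight f v'"
      using permutes_inv_o(2)[OF f] by (simp add: multiset.map_comp)
    then have "(u, v') \<in> word_cong X f" using Cons.IH u v'(1) by blast
    then have "([a] @ u, [a] @ v') \<in> word_cong X f"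
      by (rule presentation_cong.append[OF presentation_cong.refl, rotated]) (simp add: a)
    then have "(a # u, a # v') \<in> word_cong X f" by simp
    then show ?case by (rule presentation_cong.trans[OF _ presentation_cong.sym[OF v'(2)]])
  qed
qed (rule weight_eq_of_cong[OF f])

lemma weight_surj:
  assumes f: "f permutes X" and "set_mset A \<subseteq> X"
  shows "\<exists>w \<in> lists X. weight f w = A"
  using assms(2)
proof (induction "size A" arbitrary: A)
  case 0
  then show ?case by (auto intro!: bexI[of _ "[]"])
next
  case (Suc k)
  then obtain a B where A: "A = add_mset a B" by (metis size_eq_Suc_imp_eq_union)
  \<comment> \<open>The rest of the word is read one position later, so its weight is \<open>B\<close> shifted back.\<close>
  let ?B = "image_mset (inv_into UNIV f) B"
  have "set_mset ?B \<subseteq> X"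
    using Suc.prems A permutes_in_image[OF permutes_inv[OF f]] by auto
  with Suc A obtain w where w: "w \<in> lists X" "weight f w = ?B"
    by (metis size_add_mset size_image_mset nat.inject)
  have "weight f (a # w) = A"
    using A w(2) permutes_inv_o(1)[OF f] by (simp add: multiset.map_comp)
  then show ?case using w(1) Suc.prems A by (intro bexI[of _ "a # w"]) auto
qed

section \<open>Divisibility\<close>

abbreviation word_class :: "'a set \<Rightarrow> ('a \<Rightarrow> 'a) \<Rightarrow> 'a list \<Rightarrow> 'a list set" where
  "word_class X f w \<equiv> word_cong X f `` {w}"

abbreviation perm_monoid :: "'a set \<Rightarrow> ('a \<Rightarrow> 'a) \<Rightarrow> 'a list set monoid" where
  "perm_monoid X f \<equiv> structure_monoid X (permutation_solution f)"

lemma carrier_perm_monoid: "carrier (perm_monoid X f) = word_class X f ` lists X"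
  by (auto simp: structure_monoid_def presented_monoid_def quotient_def)

lemma one_perm_monoid: "\<one>\<^bsub>perm_monoid X f\<^esub> = word_class X f []"
  by (simp add: structure_monoid_def presented_monoid_def)

lemma mult_word_class:
  "u \<in> lists X \<Longrightarrow> v \<in> lists X \<Longrightarrow>
    word_class X f u \<otimes>\<^bsub>perm_monoid X f\<^esub> word_class X f v = word_class X f (u @ v)"
  unfolding structure_monoid_def by (rule presented_mult_class)

lemma word_class_eq_iff:
  assumes "f permutes X" "u \<in> lists X" "v \<in> lists X"
  shows "word_class X f u = word_class X f v \<longleftrightarrow> weight f u = weight f v"
  by (simp only: eq_equiv_class_iff[OF equiv_presentation_cong assms(2,3)]
      cong_iff_weight_eq[OF assms])

lemma image_mset_funpow_stable:
  assumes "image_mset f D = D"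
  shows "image_mset (f ^^ k) D = D"
proof (induction k)
  case (Suc k)
  then have "image_mset f (image_mset (f ^^ k) D) = D" using assms by simp
  then show ?case by (simp add: multiset.map_comp comp_def)
qed simp

text \<open>The cofactor of \<open>u\<close> in \<open>d\<close> has as its weight what \<open>u\<close> leaves of the weight of \<open>d\<close>, shifted back
  by the length of \<open>u\<close>; a word of that weight exists because the weight map is onto.\<close>

lemma left_divisors_word_class:
  assumes f: "f permutes X" and d: "d \<in> lists X"
  shows "left_divisors (perm_monoid X f) (word_class X f d)
    = word_class X f ` {u \<in> lists X. weight f u \<subseteq># weight f d}"
proof -
  have "(\<exists>t \<in> lists X. word_class X f d = word_class X f (u @ t)) \<longleftrightarrow> weight f u \<subseteq># weight f d"
    if u: "u \<in> lists X" for u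
  proof
    assume "\<exists>t \<in> lists X. word_class X f d = word_class X f (u @ t)"
    then show "weight f u \<subseteq># weight f d"
      using word_class_eq_iff[OF f d] u by (auto simp: weight_append)
  next
    assume sub: "weight f u \<subseteq># weight f d"
    let ?g = "inv_into UNIV f ^^ length u"
    let ?T = "image_mset ?g (weight f d - weight f u)"
    have "set_mset (weight f d - weight f u) \<subseteq> X"
      using weight_in_alphabet[OF f d] by (auto dest: in_diffD)
    then have "set_mset ?T \<subseteq> X"
      using permutes_in_image[OF permutes_funpow[OF permutes_inv[OF f]]] by auto
    then obtain t where t: "t \<in> lists X" "weight f t = ?T" using weight_surj[OF f] by blast
    have "(f ^^ length u) \<circ> ?g = id"
      by (auto simp: fun_eq_iff permutes_bij[OF f] inv_fn[symmetric]
          surj_f_inv_f[OF bij_is_surj])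
    then have "weight f (u @ t) = weight f d"
      using t sub by (simp add: weight_append multiset.map_comp)
    then show "\<exists>t \<in> lists X. word_class X f d = word_class X f (u @ t)"
      using t word_class_eq_iff[OF f d, of "u @ t"] u by auto
  qed
  then have divs: "{u \<in> lists X. \<exists>t \<in> lists X. word_class X f d = word_class X f (u @ t)}
      = {u \<in> lists X. weight f u \<subseteq># weight f d}"
    by (rule Collect_cong[OF conj_cong[OF HOL.refl]])
  have "left_divisors (perm_monoid X f) (word_class X f d)
      = word_class X f ` {u \<in> lists X. \<exists>t \<in> lists X. word_class X f d = word_class X f (u @ t)}"
    unfolding left_divisors_def carrier_perm_monoid Compr_image_eq bex_simps(7)
    by (intro arg_cong[where f = "image (word_class X f)"] Collect_cong
        conj_cong[OF HOL.refl] bex_cong[OF HOL.refl]) (simp only: mult_word_class)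
  then show ?thesis unfolding divs .
qed

text \<open>As a right factor, \<open>u\<close> occurs in \<open>d\<close> only through a shifted copy of its weight. Stability lets the
  same shift be applied to \<open>d\<close>, and a common shift can be cancelled.\<close>

lemma right_divisors_word_class:
  assumes f: "f permutes X" and d: "d \<in> lists X"
    and stable: "image_mset f (weight f d) = weight f d"
  shows "right_divisors (perm_monoid X f) (word_class X f d)
    = word_class X f ` {u \<in> lists X. weight f u \<subseteq># weight f d}"
proof -
  have inj: "inj (f ^^ k)" for k
    using permutes_inj[OF permutes_funpow[OF f]] .
  note stable_k = image_mset_funpow_stable[OF stable]
  have "(\<exists>t \<in> lists X. word_class X f d = word_class X f (t @ u)) \<longleftrightarrow> weight f u \<subseteq># weight f d"
    if u: "u \<in> lists X" for u
  proof
    assume "\<exists>t \<in> lists X. word_class X f d = word_class X f (t @ u)"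
    then obtain t where t: "t \<in> lists X"
      "weight f d = weight f t + image_mset (f ^^ length t) (weight f u)"
      using word_class_eq_iff[OF f d] u by (auto simp: weight_append)
    let ?g = "inv_into UNIV (f ^^ length t)"
    have "image_mset (f ^^ length t) (weight f u)
        \<subseteq># image_mset (f ^^ length t) (weight f d)"
      using t(2) stable_k by simp
    from image_mset_subseteq_mono[OF this, of ?g]
    show "weight f u \<subseteq># weight f d"
      by (simp add: multiset.map_comp inj)
  next
    assume sub: "weight f u \<subseteq># weight f d"
    \<comment> \<open>The cofactor must have this length for \<open>u\<close> to be shifted by the right power of \<open>f\<close>.\<close>
    let ?k = "length d - length u"
    let ?T = "weight f d - image_mset (f ^^ ?k) (weight f u)"
    have sub': "image_mset (f ^^ ?k) (weight f u) \<subseteq># weight f d"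
      using image_mset_subseteq_mono[OF sub, of "f ^^ ?k"] stable_k by simp
    have "set_mset ?T \<subseteq> X"
      using weight_in_alphabet[OF f d] by (auto dest: in_diffD)
    then obtain t where t: "t \<in> lists X" "weight f t = ?T" using weight_surj[OF f] by blast
    have "length t = ?k"
      using arg_cong[OF t(2), of size] sub' by (simp add: size_Diff_submset)
    then have "weight f (t @ u) = weight f d"
      using t sub' by (simp add: weight_append)
    then show "\<exists>t \<in> lists X. word_class X f d = word_class X f (t @ u)"
      using t word_class_eq_iff[OF f d, of "t @ u"] u by auto
  qed
  then have divs: "{u \<in> lists X. \<exists>t \<in> lists X. word_class X f d = word_class X f (t @ u)}
      = {u \<in> lists X. weight f u \<subseteq># weight f d}"
    by (rule Collect_cong[OF conj_cong[OF HOL.refl]])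
  have "right_divisors (perm_monoid X f) (word_class X f d)
      = word_class X f ` {u \<in> lists X. \<exists>t \<in> lists X. word_class X f d = word_class X f (t @ u)}"
    unfolding right_divisors_def carrier_perm_monoid Compr_image_eq bex_simps(7)
    by (intro arg_cong[where f = "image (word_class X f)"] Collect_cong
        conj_cong[OF HOL.refl] bex_cong[OF HOL.refl]) (simp only: mult_word_class)
  then show ?thesis unfolding divs .
qed

lemma finite_left_divisors_word_class:
  assumes f: "f permutes X" and d: "d \<in> lists X" and "finite X"
  shows "finite (left_divisors (perm_monoid X f) (word_class X f d))"
proof -
  have "{u \<in> lists X. weight f u \<subseteq># weight f d} \<subseteq> {u. set u \<subseteq> X \<and> length u \<le> length d}"
    by (auto dest: size_mset_mono)
  then have "finite {u \<in> lists X. weight f u \<subseteq># weight f d}"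
    by (rule finite_subset) (rule finite_lists_length_le[OF \<open>finite X\<close>])
  then show ?thesis unfolding left_divisors_word_class[OF f d] by (rule finite_imageI)
qed

lemma monoid_generated_by_letters:
  assumes "A \<subseteq> carrier (perm_monoid X f)" "\<And>x. x \<in> X \<Longrightarrow> word_class X f [x] \<in> A"
  shows "monoid_generated_by (perm_monoid X f) A"
  unfolding monoid_generated_by_def
proof (intro conjI allI impI)
  show "A \<subseteq> carrier (perm_monoid X f)" by fact
next
  fix H assume H: "submonoid H (perm_monoid X f) \<and> A \<subseteq> H"
  then interpret submonoid H "perm_monoid X f" by blast
  have "word_class X f w \<in> H" if "w \<in> lists X" for w
    using that
  proof (induction w)
    case Nil
    then show ?case using one_closed by (simp add: one_perm_monoid)
  next
    case (Cons a w)
    have "word_class X f [a] \<in> H" using assms(2) H Cons.hyps by blast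
    from m_closed[OF this Cons.IH] show ?case using Cons.hyps
      by (simp add: mult_word_class)
  qed
  then show "H = carrier (perm_monoid X f)" using subset by (auto simp: carrier_perm_monoid)
qed

text \<open>Stability makes left and right divisibility the same inclusion of multisets; full support
  puts every generator among the divisors.\<close>

lemma garside_element_of_stable_weight:
  assumes f: "f permutes X" and d: "d \<in> lists X"
    and stable: "image_mset f (weight f d) = weight f d"
    and full: "X \<subseteq> set_mset (weight f d)"
  shows "garside_element (perm_monoid X f) (word_class X f d)"
  unfolding garside_element_def
proof (intro conjI)
  show "word_class X f d \<in> carrier (perm_monoid X f)"
    using d by (auto simp: carrier_perm_monoid)
  show "left_divisors (perm_monoid X f) (word_class X f d)
      = right_divisors (perm_monoid X f) (word_class X f d)"
    by (simp only: left_divisors_word_class[OF f d] right_divisors_word_class[OF f d stable])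
  show "finite (left_divisors (perm_monoid X f) (word_class X f d))"
    using finite_subset[OF full] by (intro finite_left_divisors_word_class[OF f d]) simp
  show "monoid_generated_by (perm_monoid X f) (left_divisors (perm_monoid X f) (word_class X f d))"
  proof (rule monoid_generated_by_letters)
    show "left_divisors (perm_monoid X f) (word_class X f d) \<subseteq> carrier (perm_monoid X f)"
      by (auto simp: left_divisors_def)
    show "word_class X f [x] \<in> left_divisors (perm_monoid X f) (word_class X f d)" if "x \<in> X" for x
      unfolding left_divisors_word_class[OF f d]
      by (rule imageI) (use that full in auto)
  qed
qed

section \<open>Cycles\<close>

lemma cycle_of_list_nth:
  assumes "distinct cs" "j < length cs"
  shows "cycle_of_list cs (cs ! j) = cs ! (Suc j mod length cs)"
proof -
  have "map (cycle_of_list cs) cs = rotate1 cs"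
    using cyclic_rotation[OF assms(1), of 1] by simp
  then have "cycle_of_list cs (cs ! j) = rotate1 cs ! j"
    using assms(2) by (metis nth_map)
  then show ?thesis using assms(2) by (simp add: nth_rotate1)
qed

lemma mset_rotate_list: "mset (rotate k xs) = mset xs"
proof (induction k)
  case (Suc k)
  moreover have "mset (rotate1 ys) = mset ys" for ys :: "'a list" by (cases ys) auto
  ultimately show ?case by simp
qed simp

lemma foldr_cycles_outside:
  "x \<notin> set (concat css) \<Longrightarrow> foldr (\<circ>) (map cycle_of_list css) id x = x"
  by (induction css) (auto simp: id_outside_supp)

lemma foldr_cycles_on_cycle:
  assumes "distinct (concat css)" "cs \<in> set css" "x \<in> set cs"
  shows "foldr (\<circ>) (map cycle_of_list css) id x = cycle_of_list cs x"
  using assms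
proof (induction css)
  case Nil
  then show ?case by simp
next
  case (Cons bs css)
  show ?case
  proof (cases "x \<in> set bs")
    case True
    then have "x \<notin> set (concat css)" using Cons.prems(1) by auto
    then have "foldr (\<circ>) (map cycle_of_list css) id x = x" by (rule foldr_cycles_outside)
    moreover have "foldr (\<circ>) (map cycle_of_list (bs # css)) id x
        = cycle_of_list bs (foldr (\<circ>) (map cycle_of_list css) id x)" by simp
    moreover have "cs = bs"
      using \<open>x \<notin> set (concat css)\<close> Cons.prems(2,3) by auto
    ultimately show ?thesis by metis
  next
    case False
    then have cs: "cs \<in> set css" using Cons.prems(2,3) by auto
    have "distinct cs" using cs Cons.prems(1) by (auto simp: distinct_concat_iff)
    then have "cycle_of_list cs x \<in> set cs"
      using permutes_in_image[OF cycle_permutes[of cs]] Cons.prems(3) by simp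
    then have "cycle_of_list cs x \<notin> set bs" using cs Cons.prems(1) by auto
    then show ?thesis using Cons cs by (simp add: id_outside_supp)
  qed
qed

text \<open>The \<open>k\<close>-th letter of \<open>c\<^sup>m\<close> is read as \<open>f\<^sup>k c\<close>, so the powers of \<open>f\<close> run once around the
  cycle of \<open>c\<close>; starting elsewhere only rotates the cycle.\<close>

lemma weight_replicate_cycle:
  assumes "distinct cs" "\<And>x. x \<in> set cs \<Longrightarrow> f x = cycle_of_list cs x" "c \<in> set cs"
  shows "weight f (replicate (length cs) c) = mset cs"
proof -
  let ?m = "length cs"
  obtain j where j: "j < ?m" "c = cs ! j" using assms(3) by (metis in_set_conv_nth)
  have pow: "(f ^^ k) c = cs ! ((j + k) mod ?m)" for k
  proof (induction k)
    case (Suc k)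
    have "(j + k) mod ?m < ?m" using j(1) by (intro mod_less_divisor) auto
    then show ?case
      using Suc assms(2) cycle_of_list_nth[OF assms(1)] by (simp add: mod_Suc_eq)
  qed (use j in simp)
  have "weight f (replicate m c) = mset (map (\<lambda>k. (f ^^ k) c) [0..<m])" for m
  proof (induction m)
    case (Suc m)
    have "map (\<lambda>k. (f ^^ k) c) [0..<Suc m] = c # map (\<lambda>k. f ((f ^^ k) c)) [0..<m]"
      by (subst map_upt_Suc) simp
    then show ?case using Suc by (simp add: multiset.map_comp comp_def del: upt_Suc)
  qed simp
  also have "map (\<lambda>k. (f ^^ k) c) [0..<?m] = rotate j cs"
    by (rule nth_equalityI) (auto simp: pow nth_rotate add.commute)
  finally show ?thesis by (simp add: mset_rotate_list)
qed

lemma image_mset_cycle: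
  assumes "distinct cs" "\<And>x. x \<in> set cs \<Longrightarrow> f x = cycle_of_list cs x"
  shows "image_mset f (mset cs) = mset cs"
proof -
  have "map f cs = rotate 1 cs"
    using cyclic_rotation[OF assms(1), of 1] assms(2) by (simp cong: map_cong)
  then show ?thesis by (metis mset_map mset_rotate_list)
qed

text \<open>Stable multisets absorb the shift caused by the letters to their left, so products of them are
  plain sums. Both claims are proved together because the sum formula needs the stability of
  the tail.\<close>

lemma weight_concat_stable:
  assumes "\<And>w. w \<in> set ws \<Longrightarrow> image_mset f (weight f w) = weight f w"
  shows "weight f (concat ws) = sum_list (map (weight f) ws)
    \<and> image_mset f (weight f (concat ws)) = weight f (concat ws)"
  using assms
proof (induction ws)
  case (Cons w ws)
  then have "image_mset f (weight f w) = weight f w"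
    and IH: "weight f (concat ws) = sum_list (map (weight f) ws)"
      "image_mset f (weight f (concat ws)) = weight f (concat ws)"
    by auto
  moreover have "weight f (concat (w # ws)) = weight f w + weight f (concat ws)"
    using image_mset_funpow_stable[OF IH(2)] by (simp add: weight_append)
  ultimately show ?case by simp
qed simp

section \<open>The element \<open>\<Delta>\<close>\<close>

lemma word_class_pow:
  assumes "a \<in> X"
  shows "word_class X f [a] [^]\<^bsub>perm_monoid X f\<^esub> (m :: nat) = word_class X f (replicate m a)"
proof (induction m)
  case 0
  then show ?case by (simp add: one_perm_monoid nat_pow_def)
next
  case (Suc m)
  have "replicate m a @ [a] = replicate (Suc m) a" by (simp add: replicate_append_same)
  moreover have "replicate m a \<in> lists X" using assms by auto
  ultimately show ?case
    using Suc assms mult_word_class[of "replicate m a" X "[a]" f] by (simp add: nat_pow_def)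
qed

lemma concat_in_lists: "set ws \<subseteq> lists X \<Longrightarrow> concat ws \<in> lists X"
  by (induction ws) auto

lemma foldr_mult_word_class:
  assumes "set ws \<subseteq> lists X"
  shows "foldr (\<otimes>\<^bsub>perm_monoid X f\<^esub>) (map (word_class X f) ws) \<one>\<^bsub>perm_monoid X f\<^esub>
    = word_class X f (concat ws)"
  using assms
proof (induction ws)
  case (Cons w ws)
  then have "concat ws \<in> lists X" "w \<in> lists X"
    using concat_in_lists[of ws X] by simp_all
  then show ?case using Cons by (simp add: mult_word_class)
qed (simp add: one_perm_monoid)

theorem proposition10p5:
  fixes n :: nat and f :: "nat \<Rightarrow> nat"
    and ts :: "nat list list" and ss :: "nat list" and c :: "nat \<Rightarrow> nat"
  assumes "f permutes {1..n}"
    and "is_cycle_decomposition {1..n} f ts ss"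
    and "\<And>i. i < length ts \<Longrightarrow> c i \<in> set (ts ! i)"
  shows "garside_element (structure_monoid {1..n} (permutation_solution f))
    (permutation_delta (structure_monoid {1..n} (permutation_solution f))
      (structure_gen {1..n} (permutation_solution f)) ts ss c)"
proof -
  let ?X = "{1..n}"
  \<comment> \<open>A fixed point is a cycle of length one, so all factors of \<open>\<Delta>\<close> have the same form.\<close>
  define css where "css = ts @ map (\<lambda>s. [s]) ss"
  define cyc_words where "cyc_words = map (\<lambda>i. replicate (length (ts ! i)) (c i)) [0..<length ts]"
  define ws where "ws = cyc_words @ map (\<lambda>s. [s]) ss"
  have concat_ss: "concat (map (\<lambda>s. [s]) ss) = ss" by (induction ss) auto
  have dist: "distinct (concat css)" and X: "set (concat css) = ?X"
    and f_eq: "f = foldr (\<circ>) (map cycle_of_list css) id"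
    using assms(2) unfolding is_cycle_decomposition_def css_def
    by (simp_all only: concat_append concat_ss)
  have len: "length ws = length css" by (simp add: ws_def css_def cyc_words_def)
  have ws_nth: "\<exists>a \<in> set (css ! i). ws ! i = replicate (length (css ! i)) a"
    if "i < length css" for i
  proof (cases "i < length ts")
    case True
    then show ?thesis using assms(3)[OF True]
      by (auto simp: ws_def css_def nth_append cyc_words_def)
  next
    case False
    then show ?thesis using that
      by (auto simp: ws_def css_def nth_append cyc_words_def)
  qed
  have cyc: "distinct cs" "\<And>x. x \<in> set cs \<Longrightarrow> f x = cycle_of_list cs x" if "cs \<in> set css" for cs
    using that dist foldr_cycles_on_cycle[OF dist that] by (auto simp: distinct_concat_iff f_eq)
  have weight_ws: "weight f (ws ! i) = mset (css ! i)" if "i < length css" for i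
    using ws_nth[OF that] weight_replicate_cycle[OF cyc] nth_mem[OF that] by metis
  have map_weight: "map (weight f) ws = map mset css"
    by (rule nth_equalityI) (auto simp: len weight_ws)
  have "image_mset f (weight f w) = weight f w" if w: "w \<in> set ws" for w
  proof -
    obtain i where i: "i < length css" "w = ws ! i" using w len by (metis in_set_conv_nth)
    show ?thesis unfolding i(2) weight_ws[OF i(1)]
      by (rule image_mset_cycle) (use cyc[OF nth_mem[OF i(1)]] in auto)
  qed
  note ws_stable = weight_concat_stable[of ws f, OF this]
  have "sum_list (map mset css) = mset (concat css)"
    by (induction css) auto
  with ws_stable map_weight have weight: "weight f (concat ws) = mset (concat css)"
    by simp
  have ws_X: "set ws \<subseteq> lists ?X"
  proof
    fix w assume "w \<in> set ws"
    then obtain i where i: "i < length css" "w = ws ! i" using len by (metis in_set_conv_nth)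
    then obtain a where "a \<in> set (css ! i)" "w = replicate (length (css ! i)) a"
      using ws_nth by blast
    moreover from this(1) nth_mem[OF i(1)] have "a \<in> ?X" unfolding X[symmetric] by auto
    ultimately show "w \<in> lists ?X" by auto
  qed
  have c_X: "c i \<in> ?X" if "i < length ts" for i
    using assms(3)[OF that] nth_mem[OF that] unfolding X[symmetric] css_def by auto
  have "map (\<lambda>i. structure_gen ?X (permutation_solution f) (c i)
        [^]\<^bsub>perm_monoid ?X f\<^esub> length (ts ! i)) [0..<length ts]
      @ map (structure_gen ?X (permutation_solution f)) ss = map (word_class ?X f) ws"
    using c_X by (simp add: ws_def cyc_words_def structure_gen_def presented_gen_def
        word_class_pow)
  then have "permutation_delta (perm_monoid ?X f) (structure_gen ?X (permutation_solution f)) ts ss c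
      = word_class ?X f (concat ws)"
    unfolding permutation_delta_def using foldr_mult_word_class[OF ws_X] by simp
  moreover have "garside_element (perm_monoid ?X f) (word_class ?X f (concat ws))"
  proof (rule garside_element_of_stable_weight[OF assms(1)])
    show "concat ws \<in> lists ?X" by (rule concat_in_lists[OF ws_X])
    show "image_mset f (weight f (concat ws)) = weight f (concat ws)" using ws_stable by blast
    show "?X \<subseteq> set_mset (weight f (concat ws))" unfolding weight using X by simp
  qed
  ultimately show ?thesis by simp
qed

end
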